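(* Let $A\in (FW_{n-1}^n)^*$ be a matrix that is not positive semidefinite. Then $A$ spans an extreme ray of $(FW_{n-1}^n)^*$ if and only if all of the $(n-1)\times(n-1)$ principal submatrices of $A$ have rank $n-2$.
   Context: $\mathcal{S}^n$ denotes the space of real symmetric $n\times n$ matrices with inner product $\langle A,B\rangle=\operatorname{trace}(AB^T)=\sum_{i,j}A_{ij}B_{ij}$. The factor width of a real symmetric positive semidefinite $n\times n$ matrix $A$ is the smallest integer $k$ such that $A=VV^T$ for some real (rectangular) matrix $V$ each of whose columns has at most $k$ nonzero entries. $FW_k^n$ is the set of positive semidefinite $n\times n$ matrices of factor width at most $k$; it is a closed convex cone. Its dual cone is $(FW_k^n)^*=\{Y\in\mathcal{S}^n:\langle Y,X\rangle\ge 0\ \text{for all } X\in FW_k^n\}$. A nonzero element $A$ of a convex cone $C$ spans an extreme ray of $C$ if whenever $A=X+Y$ with $X,Y\in C$, both $X$ and $Y$ are nonnegative multiples of $A$.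
   Formalization: The case n = 2 is excluded, because the claim fails there: A = [[0,1],[1,0]] lies in the dual cone, is not positive semidefinite, and its 1×1 principal submatrices have rank 0 = n−2, but A = 2A + (−A) shows it does not span an extreme ray. *)

theory Defs
  imports
    Complex_Main
    "Jordan_Normal_Form.DL_Rank"
    "Jordan_Normal_Form.DL_Submatrix"
begin

definition sym_mats :: "nat \<Rightarrow> real mat set" where
  "sym_mats n = {A \<in> carrier_mat n n. transpose_mat A = A}"

definition psd_mats :: "nat \<Rightarrow> real mat set" where
  "psd_mats n = {A \<in> sym_mats n. \<forall>x \<in> carrier_vec n. 0 \<le> x \<bullet> (A *\<^sub>v x)}"

definition mat_inner :: "real mat \<Rightarrow> real mat \<Rightarrow> real" where
  "mat_inner A B = (\<Sum>i<dim_row A. \<Sum>j<dim_col A. A $$ (i, j) * B $$ (i, j))"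

text \<open>Only meaningful for positive semidefinite \<open>A\<close>: otherwise no factorization
  exists and the \<open>LEAST\<close> is unspecified.\<close>

definition factor_width :: "real mat \<Rightarrow> nat" where
  "factor_width A =
     (LEAST k. \<exists>m. \<exists>V \<in> carrier_mat (dim_row A) m.
        A = V * transpose_mat V \<and>
        (\<forall>j<m. card {i. i < dim_row A \<and> V $$ (i, j) \<noteq> 0} \<le> k))"

definition FW :: "nat \<Rightarrow> nat \<Rightarrow> real mat set" where
  "FW k n = {A \<in> psd_mats n. factor_width A \<le> k}"

definition dual_cone :: "nat \<Rightarrow> real mat set \<Rightarrow> real mat set" where
  "dual_cone n C = {Y \<in> sym_mats n. \<forall>X \<in> C. 0 \<le> mat_inner Y X}"

text \<open>The zero matrix has to be given the dimensions of \<open>A\<close>, since the type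
  of matrices does not fix them.\<close>

definition spans_extreme_ray :: "real mat set \<Rightarrow> real mat \<Rightarrow> bool" where
  "spans_extreme_ray C A \<longleftrightarrow>
     A \<in> C \<and> A \<noteq> 0\<^sub>m (dim_row A) (dim_col A) \<and>
     (\<forall>X \<in> C. \<forall>Y \<in> C. A = X + Y \<longrightarrow>
        (\<exists>a\<ge>0. X = a \<cdot>\<^sub>m A) \<and> (\<exists>b\<ge>0. Y = b \<cdot>\<^sub>m A))"

end

theory Submission
  imports Defs
begin

text \<open>
  The cone dual to \<open>FW (n - 1) n\<close> consists of the symmetric matrices whose quadratic form is
  nonnegative on vectors with a zero entry. If such an \<open>A\<close> is not positive semidefinite, then it
  is invertible: moving along a kernel vector, any vector can be given a zero entry without
  changing the value of the form. Hence the submatrix \<open>A\<^sub>i\<close>, obtained by deleting index \<open>i\<close>, has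
  corank at most one, and the rank condition says that every \<open>A\<^sub>i\<close> is singular.

  If some \<open>A\<^sub>i\<close> is nonsingular, let \<open>a\<close> be column \<open>i\<close> of \<open>A\<close>. Cauchy-Schwarz on each coordinate
  hyperplane shows that \<open>A - t a a\<^sup>T\<close> is still in the dual cone for small \<open>t > 0\<close>, so \<open>A\<close> has a
  nonzero positive semidefinite summand and is not extreme. If all \<open>A\<^sub>i\<close> are singular, there are
  vectors \<open>p\<^sub>i\<close> with \<open>A p\<^sub>i = e\<^sub>i\<close> on which the forms of \<open>A\<close> and of each of its summands \<open>X\<close> in the
  cone vanish. Then \<open>X p\<^sub>i\<close> is a multiple of \<open>e\<^sub>i\<close>, so \<open>X = D A\<close> with \<open>D\<close> diagonal. If \<open>D\<close> is not
  scalar, symmetry of \<open>X\<close> makes \<open>A\<close> block diagonal, hence positive semidefinite.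
\<close>

section \<open>Quadratic forms and rank\<close>

text \<open>Vectors and matrices are plain functions on indices, of which only the values below
  \<open>n\<close> count; shrinking, reindexing and padding then need no dimension
  conditions.\<close>

definition mulv :: "nat \<Rightarrow> (nat \<Rightarrow> nat \<Rightarrow> real) \<Rightarrow> (nat \<Rightarrow> real) \<Rightarrow> nat \<Rightarrow> real" where
  "mulv n a x i = (\<Sum>j<n. a i j * x j)"

definition bform :: "nat \<Rightarrow> (nat \<Rightarrow> nat \<Rightarrow> real) \<Rightarrow> (nat \<Rightarrow> real) \<Rightarrow> (nat \<Rightarrow> real) \<Rightarrow> real" where
  "bform n a x y = (\<Sum>i<n. \<Sum>j<n. x i * a i j * y j)"

definition unitv :: "nat \<Rightarrow> nat \<Rightarrow> real" where
  "unitv i = (\<lambda>j. if j = i then 1 else 0)"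

lemma unitv_simps: "unitv i i = 1" "i \<noteq> j \<Longrightarrow> unitv i j = 0"
  by (simp_all add: unitv_def)

definition symm :: "nat \<Rightarrow> (nat \<Rightarrow> nat \<Rightarrow> real) \<Rightarrow> bool" where
  "symm n a \<longleftrightarrow> (\<forall>i<n. \<forall>j<n. a i j = a j i)"

lemma mulv_add: "mulv n a (\<lambda>k. x k + y k) i = mulv n a x i + mulv n a y i"
  by (simp add: mulv_def algebra_simps sum.distrib)

lemma mulv_diff: "mulv n a (\<lambda>k. x k - y k) i = mulv n a x i - mulv n a y i"
  by (simp add: mulv_def algebra_simps sum_subtractf)

lemma mulv_scale: "mulv n a (\<lambda>k. c * x k) i = c * mulv n a x i"
  by (simp add: mulv_def algebra_simps sum_distrib_left)

lemma mulv_sum: "mulv n a (\<lambda>k. \<Sum>l<m. c l * x l k) i = (\<Sum>l<m. c l * mulv n a (x l) i)"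
proof -
  have "mulv n a (\<lambda>k. \<Sum>l<m. c l * x l k) i = (\<Sum>j<n. \<Sum>l<m. c l * (a i j * x l j))"
    by (simp add: mulv_def sum_distrib_left algebra_simps)
  also have "\<dots> = (\<Sum>l<m. c l * mulv n a (x l) i)"
    by (subst sum.swap) (simp add: mulv_def sum_distrib_left)
  finally show ?thesis .
qed

lemma mulv_unitv: "j < n \<Longrightarrow> mulv n a (unitv j) i = a i j"
  by (simp add: mulv_def unitv_def if_distrib[of "(*) _"] cong: if_cong)

lemma mulv_cong: "(\<And>j. j < n \<Longrightarrow> x j = y j) \<Longrightarrow> mulv n a x i = mulv n a y i"
  by (simp add: mulv_def)

lemma bform_mulv: "bform n a x y = (\<Sum>i<n. x i * mulv n a y i)"
  by (simp add: bform_def mulv_def sum_distrib_left mult.assoc)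

lemma bform_cong:
  "(\<And>i. i < n \<Longrightarrow> x i = x' i) \<Longrightarrow> (\<And>i. i < n \<Longrightarrow> y i = y' i) \<Longrightarrow> bform n a x y = bform n a x' y'"
  by (simp add: bform_def)

lemma bform_add_left: "bform n a (\<lambda>k. x k + y k) z = bform n a x z + bform n a y z"
  by (simp add: bform_mulv algebra_simps sum.distrib)

lemma bform_scale_left: "bform n a (\<lambda>k. c * x k) z = c * bform n a x z"
  by (simp add: bform_mulv algebra_simps sum_distrib_left)

lemma bform_add_right: "bform n a z (\<lambda>k. x k + y k) = bform n a z x + bform n a z y"
  by (simp add: bform_mulv mulv_add algebra_simps sum.distrib)

lemma bform_scale_right: "bform n a z (\<lambda>k. c * x k) = c * bform n a z x"
  by (simp add: bform_mulv mulv_scale algebra_simps sum_distrib_left)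

lemma bform_add_coeffs: "bform n (\<lambda>i j. a i j + b i j) x y = bform n a x y + bform n b x y"
  by (simp add: bform_def algebra_simps sum.distrib)

lemma bform_diff_coeffs: "bform n (\<lambda>i j. a i j - b i j) x y = bform n a x y - bform n b x y"
  by (simp add: bform_def algebra_simps sum_subtractf)

lemma bform_scale_coeffs: "bform n (\<lambda>i j. c * a i j) x y = c * bform n a x y"
  by (simp add: bform_def sum_distrib_left algebra_simps)

lemma bform_rank_one: "bform n (\<lambda>i j. c i * c j) x x = (\<Sum>i<n. c i * x i)\<^sup>2"
  by (simp add: bform_def power2_eq_square sum_product algebra_simps)

lemma bform_unitv_left: "i < n \<Longrightarrow> bform n a (unitv i) y = mulv n a y i"
  by (simp add: bform_mulv unitv_def if_distrib[of "\<lambda>c. c * _"] cong: if_cong)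

lemma bform_sym:
  assumes "symm n a"
  shows "bform n a x y = bform n a y x"
proof -
  have "bform n a x y = (\<Sum>j<n. \<Sum>i<n. x i * a i j * y j)"
    unfolding bform_def by (rule sum.swap)
  also have "\<dots> = bform n a y x"
    using assms unfolding bform_def symm_def by (intro sum.cong) auto
  finally show ?thesis .
qed

lemma bform_add_both:
  assumes "symm n a"
  shows "bform n a (\<lambda>k. x k + s * y k) (\<lambda>k. x k + s * y k) =
    bform n a x x + 2 * s * bform n a x y + s\<^sup>2 * bform n a y y"
  by (simp add: bform_add_left bform_add_right bform_scale_left bform_scale_right
      bform_sym[OF assms, of y x] power2_eq_square algebra_simps)

text \<open>Once the leading coefficient is known to be nonnegative, the bound is read off at the
  vertex \<open>-b / q\<close>, or from \<open>b = 0\<close> when \<open>q = 0\<close>.\<close>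

lemma nonneg_quadratic_discriminant:
  fixes p b q :: real
  assumes "\<And>s. 0 \<le> p + 2 * s * b + s\<^sup>2 * q"
  shows "b\<^sup>2 \<le> p * q"
proof -
  have q: "0 \<le> q"
  proof (rule ccontr)
    assume q: "\<not> 0 \<le> q"
    \<comment> \<open>This choice gives \<open>s * q = q - \<bar>p\<bar>\<close>. Adding the values
      at \<open>s\<close> and \<open>-s\<close> cancels the linear term and leaves something
      negative.\<close>
    define s where "s = 1 + \<bar>p\<bar> / (-q)"
    have "s \<ge> 1" using q by (simp add: s_def divide_nonneg_neg)
    then have "s\<^sup>2 \<ge> s" by (simp add: power2_eq_square)
    then have "s\<^sup>2 * q \<le> s * q" using q by (simp add: mult_right_mono_neg)
    moreover have "s * q = q - \<bar>p\<bar>" using q by (simp add: s_def field_simps)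
    ultimately have "p + s\<^sup>2 * q < 0" using q by linarith
    then show False using assms[of s] assms[of "-s"] by simp
  qed
  show ?thesis
  proof (cases "q = 0")
    case True
    have "b = 0"
    proof (rule ccontr)
      assume b: "b \<noteq> 0"
      \<comment> \<open>At this argument the affine function takes the value
        \<open>-1\<close>.\<close>
      then show False using assms[of "-(p + 1) / (2 * b)"] True by (simp add: field_simps)
    qed
    then show ?thesis using True by simp
  next
    case False
    then have "q * (p + 2 * (-b / q) * b + (-b / q)\<^sup>2 * q) = p * q - b\<^sup>2"
      by (simp add: field_simps power2_eq_square)
    moreover have "0 \<le> q * (p + 2 * (-b / q) * b + (-b / q)\<^sup>2 * q)"
      using assms[of "-b / q"] q by (intro mult_nonneg_nonneg) auto
    ultimately show ?thesis by linarith
  qed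
qed

text \<open>Nonnegativity is asked for only along the line through \<open>x\<close> in direction
  \<open>y\<close>, so the inequality is available inside a coordinate hyperplane.\<close>

lemma bform_Cauchy_Schwarz:
  assumes "symm n a" "\<And>s. 0 \<le> bform n a (\<lambda>k. x k + s * y k) (\<lambda>k. x k + s * y k)"
  shows "(bform n a x y)\<^sup>2 \<le> bform n a x x * bform n a y y"
  using nonneg_quadratic_discriminant[of "bform n a x x" "bform n a x y" "bform n a y y"]
    assms(2) by (simp add: bform_add_both[OF assms(1)])

section \<open>Kernels, solvability and rank\<close>

lemma det_zero_iff_mulv:
  "det (mat m m (\<lambda>(i, j). a i j)) = (0::real) \<longleftrightarrow>
    (\<exists>x. (\<exists>i<m. x i \<noteq> 0) \<and> (\<forall>i<m. mulv m a x i = 0))"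
proof -
  let ?M = "mat m m (\<lambda>(i, j). a i j)"
  have eq: "?M *\<^sub>v vec m x = vec m (mulv m a x)" for x
    by (rule eq_vecI) (auto simp: scalar_prod_def mulv_def atLeast0LessThan)
  have zero: "vec m x = 0\<^sub>v m \<longleftrightarrow> (\<forall>i<m. x i = 0)" for x :: "nat \<Rightarrow> real"
    by (auto simp: vec_eq_iff)
  have "det ?M = 0 \<longleftrightarrow> (\<exists>v. v \<in> carrier_vec m \<and> v \<noteq> 0\<^sub>v m \<and> ?M *\<^sub>v v = 0\<^sub>v m)"
    by (rule det_0_iff_vec_prod_zero_field) simp
  also have "\<dots> \<longleftrightarrow> (\<exists>x. vec m x \<noteq> 0\<^sub>v m \<and> ?M *\<^sub>v vec m x = 0\<^sub>v m)"
  proof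
    assume "\<exists>v. v \<in> carrier_vec m \<and> v \<noteq> 0\<^sub>v m \<and> ?M *\<^sub>v v = 0\<^sub>v m"
    then obtain v where v: "v \<in> carrier_vec m" "v \<noteq> 0\<^sub>v m" "?M *\<^sub>v v = 0\<^sub>v m" by blast
    moreover from v(1) have "vec m (($) v) = v" by auto
    ultimately show "\<exists>x. vec m x \<noteq> 0\<^sub>v m \<and> ?M *\<^sub>v vec m x = 0\<^sub>v m" by metis
  qed (use vec_carrier in blast)
  finally show ?thesis by (simp add: eq zero)
qed

lemma mulv_solvable:
  assumes inj: "\<And>x. \<forall>i<n. mulv n a x i = 0 \<Longrightarrow> \<forall>i<n. x i = 0"
  obtains p where "\<And>i. i < n \<Longrightarrow> mulv n a p i = y i"
proof -
  let ?M = "mat n n (\<lambda>(i, j). a i j)"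
  have "det ?M \<noteq> 0"
    using inj by (auto simp: det_zero_iff_mulv)
  then have "?M \<in> Units (ring_mat TYPE(real) n ())"
    by (intro det_non_zero_imp_unit) auto
  then obtain B where B: "B \<in> carrier_mat n n" "?M * B = 1\<^sub>m n"
    unfolding Units_def ring_mat_def by auto
  define p where "p = ($) (B *\<^sub>v vec n y)"
  have "vec n p = B *\<^sub>v vec n y"
    using B by (auto simp: p_def)
  moreover have "?M *\<^sub>v vec n p = vec n (mulv n a p)"
    by (rule eq_vecI) (auto simp: scalar_prod_def mulv_def atLeast0LessThan)
  moreover have "?M *\<^sub>v (B *\<^sub>v vec n y) = vec n y"
    using B by (subst assoc_mult_mat_vec[symmetric, of _ n n _ n]) auto
  ultimately have "vec n (mulv n a p) = vec n y" by simp
  then have "mulv n a p i = y i" if "i < n" for i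
    using that by (metis index_vec)
  then show ?thesis using that by blast
qed

text \<open>The hypotheses make \<open>u\<close> span the kernel. Adding the matrix with entries
  \<open>u i * u j\<close> produces an invertible matrix and raises the rank by at most one.\<close>

lemma rank_corank_one:
  fixes a :: "nat \<Rightarrow> nat \<Rightarrow> real"
  assumes sym: "symm m a"
    and u: "\<forall>i<m. mulv m a u i = 0" "\<exists>i<m. u i \<noteq> 0"
    and one_dim: "\<And>x. \<forall>i<m. mulv m a x i = 0 \<Longrightarrow> (\<Sum>i<m. u i * x i) = 0 \<Longrightarrow> \<forall>i<m. x i = 0"
  shows "Suc (vec_space.rank m (mat m m (\<lambda>(i, j). a i j))) = m"
proof -
  interpret vec_space "TYPE(real)" m .
  let ?M = "mat m m (\<lambda>(i, j). a i j)"
  let ?U = "mat m m (\<lambda>(i, j). u i * u j)"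
  have "det ?M = 0"
    unfolding det_zero_iff_mulv using u by blast
  then have less: "rank ?M < m"
    by (intro det_zero_low_rank) auto
  have "\<forall>i<m. x i = 0" if x: "\<forall>i<m. mulv m (\<lambda>i j. a i j + u i * u j) x i = 0" for x
  proof -
    define s where "s = (\<Sum>i<m. u i * x i)"
    have split: "mulv m (\<lambda>i j. a i j + u i * u j) x i = mulv m a x i + u i * s" for i
      by (simp add: mulv_def s_def algebra_simps sum.distrib sum_distrib_left)
    have pos: "(\<Sum>i<m. u i * u i) \<noteq> 0"
      using u(2) by (subst sum_nonneg_eq_0_iff) auto
    \<comment> \<open>Pairing with \<open>u\<close> removes the \<open>a\<close> part, as
      \<open>u\<close> is in the kernel and \<open>a\<close> is symmetric.\<close>
    have "0 = (\<Sum>i<m. u i * (mulv m a x i + u i * s))"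
      using x split by simp
    also have "\<dots> = bform m a u x + s * (\<Sum>i<m. u i * u i)"
      by (simp add: bform_mulv algebra_simps sum.distrib sum_distrib_left)
    also have "bform m a u x = 0"
      using u(1) by (subst bform_sym[OF sym]) (simp add: bform_mulv)
    finally have "s = 0" using pos by simp
    then show ?thesis
      using one_dim[of x] x split by (simp add: s_def)
  qed
  then have "det (mat m m (\<lambda>(i, j). a i j + u i * u j)) \<noteq> 0"
    unfolding det_zero_iff_mulv by blast
  moreover have "mat m m (\<lambda>(i, j). a i j + u i * u j) = ?M + ?U"
    by (rule eq_matI) auto
  ultimately have "rank (?M + ?U) = m"
    using low_rank_det_zero[of "?M + ?U"] by simp
  moreover have "rank (?M + ?U) \<le> rank ?M + rank ?U"
    by (rule rank_subadditive) auto
  moreover have "rank ?U \<le> 1"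
    by (rule rank_le_1_product_entries[of _ m u u]) auto
  ultimately show ?thesis using less by linarith
qed

section \<open>Forms nonnegative on coordinate hyperplanes\<close>

text \<open>Positive semidefiniteness of all proper principal submatrices.\<close>

definition sparse_nonneg :: "nat \<Rightarrow> (nat \<Rightarrow> nat \<Rightarrow> real) \<Rightarrow> bool" where
  "sparse_nonneg n a \<longleftrightarrow> (\<forall>x i. i < n \<longrightarrow> x i = 0 \<longrightarrow> 0 \<le> bform n a x x)"

lemma sparse_nonnegD: "sparse_nonneg n a \<Longrightarrow> i < n \<Longrightarrow> x i = 0 \<Longrightarrow> 0 \<le> bform n a x x"
  by (auto simp: sparse_nonneg_def)

lemma sparse_Cauchy_Schwarz:
  assumes "symm n a" "sparse_nonneg n a" "i < n" "x i = 0" "y i = 0"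
  shows "(bform n a x y)\<^sup>2 \<le> bform n a x x * bform n a y y"
  using assms by (intro bform_Cauchy_Schwarz sparse_nonnegD) auto

locale sparse_nonneg_indefinite =
  fixes n :: nat and a :: "nat \<Rightarrow> nat \<Rightarrow> real"
  assumes sym: "symm n a"
    and nonneg: "sparse_nonneg n a"
    and indefinite: "\<exists>x. bform n a x x < 0"
begin

text \<open>Singularity of the principal submatrix obtained by deleting index \<open>i\<close>.\<close>

definition singular_at :: "nat \<Rightarrow> bool" where
  "singular_at i \<longleftrightarrow> (\<exists>u. u i = 0 \<and> (\<exists>j<n. u j \<noteq> 0) \<and> (\<forall>r<n. r \<noteq> i \<longrightarrow> mulv n a u r = 0))"

lemma regular:
  assumes "\<forall>i<n. mulv n a w i = 0"
  shows "\<forall>i<n. w i = 0"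
proof (rule ccontr)
  assume "\<not> (\<forall>i<n. w i = 0)"
  then obtain j where j: "j < n" "w j \<noteq> 0" by auto
  obtain x where x: "bform n a x x < 0" using indefinite by blast
  \<comment> \<open>With this \<open>s\<close>, entry \<open>j\<close> of the shifted vector is
    zero.\<close>
  define s where "s = - x j / w j"
  have "bform n a y w = 0" for y
    using assms by (simp add: bform_mulv)
  then have "bform n a (\<lambda>k. x k + s * w k) (\<lambda>k. x k + s * w k) = bform n a x x"
    by (simp add: bform_add_both[OF sym])
  moreover have "0 \<le> bform n a (\<lambda>k. x k + s * w k) (\<lambda>k. x k + s * w k)"
    using j by (intro sparse_nonnegD[OF nonneg j(1)]) (simp add: s_def)
  ultimately show False using x by simp
qed

text \<open>The subtracted form is \<open>t\<close> times the square of \<open>mulv n a x i\<close>.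
  On each coordinate hyperplane this functional is the pairing under \<open>a\<close> with a vector
  of that hyperplane, so Cauchy-Schwarz bounds its square by a constant times the form of
  \<open>a\<close>. Two constants suffice, since \<open>unitv i\<close> lies in all hyperplanes but
  one.\<close>

lemma subtract_rank_one:
  assumes i: "i < n"
    and nonsing: "\<not> singular_at i"
  shows "\<exists>t>0. sparse_nonneg n (\<lambda>r s. a r s - t * (a r i * a s i))"
proof -
  obtain p where p: "\<And>r. r < n \<Longrightarrow> mulv n a p r = unitv i r"
    using mulv_solvable[of n a "unitv i"] regular by blast
  \<comment> \<open>If \<open>p i = 0\<close>, then \<open>p\<close> restricts to a kernel vector of
    a nonsingular submatrix, so \<open>p\<close> is zero, against
    \<open>mulv n a p i = 1\<close>.\<close>
  have pi: "p i \<noteq> 0"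
  proof
    assume "p i = 0"
    moreover have "\<forall>r<n. r \<noteq> i \<longrightarrow> mulv n a p r = 0"
      using p by (simp add: unitv_def)
    ultimately have "\<forall>j<n. p j = 0"
      using nonsing unfolding singular_at_def by blast
    then have "mulv n a p i = 0" by (simp add: mulv_def)
    then show False using p[OF i] by (simp add: unitv_def)
  qed
  \<comment> \<open>\<open>w\<close> represents the functional \<open>x \<mapsto> mulv n a x i\<close> on the hyperplane \<open>x i = 0\<close>,
    where \<open>a\<close> is positive semidefinite; \<open>unitv i\<close> represents it on the others.\<close>
  define w where "w = (\<lambda>k. unitv i k + (- 1 / p i) * p k)"
  have wi: "w i = 0" using pi by (simp add: w_def unitv_def)
  define d where "d = bform n a (unitv i) (unitv i)"
  define q where "q = bform n a w w"
  define t where "t = 1 / (1 + \<bar>d\<bar> + \<bar>q\<bar>)"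
  have t: "t > 0" "t * d \<le> 1" "t * q \<le> 1"
    by (auto simp: t_def field_simps)
  have col: "(\<Sum>r<n. a r i * x r) = mulv n a x i" for x
    using sym i unfolding mulv_def symm_def by (intro sum.cong) auto
  have "0 \<le> bform n (\<lambda>r s. a r s - t * (a r i * a s i)) x x" if j: "j < n" "x j = 0" for x j
  proof -
    have x: "0 \<le> bform n a x x" using sparse_nonnegD[OF nonneg] j by blast
    obtain e where e: "(mulv n a x i)\<^sup>2 \<le> e * bform n a x x" "t * e \<le> 1"
    proof (cases "j = i")
      case True
      \<comment> \<open>\<open>p\<close> is orthogonal under \<open>a\<close> to the hyperplane
        \<open>x i = 0\<close>, so replacing \<open>unitv i\<close> by \<open>w\<close> keeps the
        pairing with \<open>x\<close>.\<close>
      have "bform n a p x = (\<Sum>k<n. x k * unitv i k)"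
        by (subst bform_sym[OF sym]) (simp add: bform_mulv p)
      also have "\<dots> = 0"
        using True j by (intro sum.neutral) (auto simp: unitv_def)
      finally have "bform n a w x = mulv n a x i"
        unfolding w_def bform_add_left bform_scale_left by (simp add: bform_unitv_left i)
      then show ?thesis
        using that[of q] t(3) sparse_Cauchy_Schwarz[OF sym nonneg i, of w x] wi True j
        by (simp add: q_def)
    next
      case False
      then have "unitv i j = 0" by (simp add: unitv_def)
      then show ?thesis
        using that[of d] t(2) sparse_Cauchy_Schwarz[OF sym nonneg j(1), of "unitv i" x] j(2)
        by (simp add: d_def bform_unitv_left i)
    qed
    have "t * (mulv n a x i)\<^sup>2 \<le> t * (e * bform n a x x)"
      using e t by (intro mult_left_mono) auto
    also have "\<dots> = t * e * bform n a x x" by simp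
    also have "\<dots> \<le> 1 * bform n a x x"
      using e x by (intro mult_right_mono) auto
    finally show ?thesis
      by (simp add: bform_diff_coeffs bform_scale_coeffs bform_rank_one col)
  qed
  then show ?thesis using t(1) unfolding sparse_nonneg_def by blast
qed

text \<open>The vectors \<open>p i\<close> are the columns of the inverse of \<open>a\<close>. The
  form at \<open>p i\<close> equals the diagonal entry \<open>p i i\<close>, and singularity at
  \<open>i\<close> says that this entry is zero.\<close>

lemma summand_row_scaling:
  assumes b: "symm n b" "sparse_nonneg n b" and c: "sparse_nonneg n c"
    and sum: "\<And>r s. r < n \<Longrightarrow> s < n \<Longrightarrow> a r s = b r s + c r s"
    and sing: "\<And>i. i < n \<Longrightarrow> singular_at i"
  shows "\<exists>l. \<forall>r<n. \<forall>s<n. b r s = l r * a r s"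
proof -
  have "\<exists>p l. \<forall>r<n. mulv n a p r = unitv i r \<and> mulv n b p r = l * unitv i r" if i: "i < n" for i
  proof -
    obtain u where u: "u i = 0" "\<exists>j<n. u j \<noteq> 0" "\<forall>r<n. r \<noteq> i \<longrightarrow> mulv n a u r = 0"
      using sing[OF i] unfolding singular_at_def by blast
    define d where "d = mulv n a u i"
    \<comment> \<open>For \<open>d = 0\<close> the nonzero \<open>u\<close> would lie in the kernel
      of \<open>a\<close>.\<close>
    have d: "d \<noteq> 0"
      using regular[of u] u unfolding d_def by metis
    define p where "p = (\<lambda>k. (1 / d) * u k)"
    have pi: "p i = 0" using u by (simp add: p_def)
    have ap: "mulv n a p r = unitv i r" if "r < n" for r
      unfolding p_def mulv_scale using that u d by (cases "r = i") (auto simp: unitv_def d_def)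
    have "bform n a p p = (\<Sum>k<n. p k * unitv i k)"
      using ap by (simp add: bform_mulv)
    also have "\<dots> = 0"
      using pi by (intro sum.neutral) (auto simp: unitv_def)
    finally have "bform n a p p = 0" .
    moreover have "bform n a p p = bform n b p p + bform n c p p"
      unfolding bform_add_coeffs[symmetric] by (simp add: bform_def sum)
    moreover have "0 \<le> bform n b p p" "0 \<le> bform n c p p"
      using sparse_nonnegD[OF b(2) i, of p] sparse_nonnegD[OF c i, of p] pi by simp_all
    ultimately have bpp: "bform n b p p = 0" by linarith
    \<comment> \<open>\<open>unitv r\<close> also vanishes at \<open>i\<close>, so Cauchy-Schwarz
      applies to \<open>b\<close>, whose form is zero at \<open>p\<close>.\<close>
    have "mulv n b p r = 0" if r: "r < n" "r \<noteq> i" for r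
      using sparse_Cauchy_Schwarz[OF b i, of "unitv r" p] r bpp pi
      by (simp add: bform_unitv_left unitv_simps)
    then have "mulv n b p r = mulv n b p i * unitv i r" if "r < n" for r
      using that by (cases "r = i") (auto simp: unitv_def)
    then show ?thesis using ap by blast
  qed
  then obtain p l where p: "\<And>i r. i < n \<Longrightarrow> r < n \<Longrightarrow> mulv n a (p i) r = unitv i r"
      "\<And>i r. i < n \<Longrightarrow> r < n \<Longrightarrow> mulv n b (p i) r = l i * unitv i r"
    by metis
  have "b r s = l r * a r s" if rs: "r < n" "s < n" for r s
  proof -
    \<comment> \<open>Both \<open>unitv s\<close> and the combination of the \<open>p q\<close> are
      mapped by \<open>a\<close> to its column \<open>s\<close>. Hence \<open>x\<close> is a kernel
      vector, so zero, and applying \<open>b\<close> to it determines \<open>b r s\<close>.\<close>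
    define x where "x = (\<lambda>k. unitv s k - (\<Sum>q<n. a q s * p q k))"
    have delta: "(\<Sum>q<n. f q * unitv q k) = f k" if "k < n" for k and f :: "nat \<Rightarrow> real"
      using that by (simp add: unitv_def if_distrib[of "(*) _"] cong: if_cong)
    have "mulv n a x k = 0" if "k < n" for k
      using that rs by (simp add: x_def mulv_diff mulv_sum mulv_unitv p delta)
    then have "\<forall>k<n. x k = 0" using regular by blast
    then have "mulv n b x r = 0" by (simp add: mulv_def)
    moreover have "mulv n b x r = b r s - (\<Sum>q<n. a q s * l q * unitv q r)"
      using rs by (simp add: x_def mulv_diff mulv_sum mulv_unitv p mult.assoc)
    ultimately show ?thesis using delta[OF rs(1)] by simp
  qed
  then show ?thesis by blast
qed

text \<open>Two values of \<open>l\<close> would split every vector into two parts that are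
  orthogonal under \<open>a\<close> and have a zero entry each, making the form of \<open>a\<close>
  nonnegative.\<close>

lemma row_scaling_constant:
  assumes b: "symm n b" "\<forall>r<n. \<forall>s<n. b r s = l r * a r s"
    and ij: "i < n" "j < n"
  shows "l i = l j"
proof (rule ccontr)
  assume neq: "l i \<noteq> l j"
  obtain x where x: "bform n a x x < 0" using indefinite by blast
  \<comment> \<open>Symmetry of \<open>b\<close> makes \<open>a\<close> block diagonal along the level sets of \<open>l\<close>.\<close>
  define y where "y = (\<lambda>k. if l k = l i then x k else 0)"
  define z where "z = (\<lambda>k. if l k = l i then 0 else x k)"
  have "a r s = 0" if "r < n" "s < n" "l r \<noteq> l s" for r s
    using b sym that unfolding symm_def by (metis mult_cancel_right)
  then have "bform n a y z = 0"
    by (auto simp: bform_def y_def z_def intro!: sum.neutral)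
  moreover have "x = (\<lambda>k. y k + 1 * z k)"
    by (auto simp: y_def z_def)
  ultimately have "bform n a x x = bform n a y y + bform n a z z"
    by (simp only: bform_add_both[OF sym]) simp
  moreover have "0 \<le> bform n a y y"
    using neq by (intro sparse_nonnegD[OF nonneg ij(2)]) (simp add: y_def)
  moreover have "0 \<le> bform n a z z"
    by (intro sparse_nonnegD[OF nonneg ij(1)]) (simp add: z_def)
  ultimately show False using x by linarith
qed

text \<open>For \<open>l < 0\<close> the form of \<open>a\<close> vanishes at every unit vector.
  Since \<open>n \<ge> 3\<close>, any two unit vectors share a zero entry, and Cauchy-Schwarz makes
  all entries zero. For \<open>n = 2\<close> the form \<open>2 * x 0 * x 1\<close> and its negative
  are both nonnegative on the coordinate hyperplanes.\<close>

lemma multiple_sparse_nonneg: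
  assumes n: "n \<ge> 3" and b: "sparse_nonneg n b" "\<forall>r<n. \<forall>s<n. b r s = l * a r s"
  shows "l \<ge> 0"
proof (rule ccontr)
  assume l: "\<not> l \<ge> 0"
  have "a r s = 0" if rs: "r < n" "s < n" for r s
  proof -
    have "card {r, s} < card {..<n}"
      using n card_insert_le_m1[of 2 "{s}" r] by simp
    then have "\<not> {..<n} \<subseteq> {r, s}"
      by (meson card_mono finite.emptyI finite.insertI leD)
    then obtain k where "k < n" "k \<noteq> r" "k \<noteq> s" by auto
    then have k: "k < n" "unitv r k = 0" "unitv s k = 0"
      by (simp_all add: unitv_def)
    have "bform n b (unitv r) (unitv r) = l * bform n a (unitv r) (unitv r)"
      unfolding bform_scale_coeffs[symmetric] using b(2) by (simp add: bform_def)
    moreover have "0 \<le> bform n b (unitv r) (unitv r)" "0 \<le> bform n a (unitv r) (unitv r)"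
      using sparse_nonnegD[OF b(1) k(1), of "unitv r"] sparse_nonnegD[OF nonneg k(1), of "unitv r"] k(2)
      by simp_all
    ultimately have "bform n a (unitv r) (unitv r) = 0"
      using l by (simp add: zero_le_mult_iff)
    then have "bform n a (unitv r) (unitv s) = 0"
      using sparse_Cauchy_Schwarz[OF sym nonneg k(1), of "unitv r" "unitv s"] k by simp
    then show ?thesis using rs by (simp add: bform_unitv_left mulv_unitv)
  qed
  then show False using indefinite by (simp add: bform_def)
qed

lemma summand_multiple:
  assumes n: "n \<ge> 3"
    and b: "symm n b" "sparse_nonneg n b" and c: "sparse_nonneg n c"
    and sum: "\<And>r s. r < n \<Longrightarrow> s < n \<Longrightarrow> a r s = b r s + c r s"
    and sing: "\<And>i. i < n \<Longrightarrow> singular_at i"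
  shows "\<exists>l\<ge>0. \<forall>r<n. \<forall>s<n. b r s = l * a r s"
proof -
  obtain l where l: "\<forall>r<n. \<forall>s<n. b r s = l r * a r s"
    using summand_row_scaling[OF b c sum sing] ..
  have "\<forall>r<n. l r = l 0"
  proof (intro allI impI)
    fix r assume "r < n"
    then show "l r = l 0" using row_scaling_constant[OF b(1) l, of r 0] n by linarith
  qed
  then have "\<forall>r<n. \<forall>s<n. b r s = l 0 * a r s" using l by metis
  then show ?thesis using multiple_sparse_nonneg[OF n b(2)] by blast
qed

text \<open>\<open>a\<close> sends \<open>u\<close> and \<open>x\<close> to multiples of
  \<open>unitv i\<close>, so a combination of them is in the kernel of \<open>a\<close> and
  vanishes. Deleting one index thus gives corank at most one.\<close>

lemma principal_kernel_one_dim: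
  assumes u: "u i = 0" "\<exists>j<n. u j \<noteq> 0" "\<forall>r<n. r \<noteq> i \<longrightarrow> mulv n a u r = 0"
    and x: "x i = 0" "\<forall>r<n. r \<noteq> i \<longrightarrow> mulv n a x r = 0"
    and orth: "(\<Sum>k<n. u k * x k) = 0"
  shows "\<forall>k<n. x k = 0"
proof -
  define d where "d = mulv n a u i"
  define e where "e = mulv n a x i"
  have "mulv n a (\<lambda>k. e * u k - d * x k) r = 0" if "r < n" for r
    unfolding mulv_diff mulv_scale using u x that by (cases "r = i") (auto simp: d_def e_def)
  then have proportional: "e * u k = d * x k" if "k < n" for k
    using regular[of "\<lambda>k. e * u k - d * x k"] that by simp
  have "e * (\<Sum>k<n. u k * u k) = (\<Sum>k<n. u k * (d * x k))"
    unfolding sum_distrib_left using proportional by (intro sum.cong) (auto simp: mult.left_commute)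
  also have "\<dots> = d * (\<Sum>k<n. u k * x k)"
    by (simp add: sum_distrib_left mult.left_commute)
  finally have "e * (\<Sum>k<n. u k * u k) = 0" using orth by simp
  moreover have "(\<Sum>k<n. u k * u k) \<noteq> 0"
    using u(2) by (subst sum_nonneg_eq_0_iff) auto
  ultimately have "e = 0" by simp
  then have "\<forall>r<n. mulv n a x r = 0"
    using x(2) unfolding e_def by blast
  then show ?thesis by (rule regular)
qed

end

section \<open>Factor width and its dual cone\<close>

lemma bform_Suc:
  assumes "symm (Suc n) a"
  shows "bform (Suc n) a x x =
    bform n a x x + 2 * x n * (\<Sum>i<n. x i * a i n) + (x n)\<^sup>2 * a n n"
proof -
  have "(\<Sum>i<n. x n * a n i * x i) = x n * (\<Sum>i<n. x i * a i n)"
    using assms unfolding symm_def sum_distrib_left by (intro sum.cong) auto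
  moreover have "(\<Sum>i<n. x i * a i n * x n) = x n * (\<Sum>i<n. x i * a i n)"
    unfolding sum_distrib_left by (intro sum.cong) auto
  ultimately show ?thesis
    by (simp add: bform_def sum.distrib power2_eq_square)
qed

text \<open>Cholesky factorization by induction: \<open>b\<close> is the Schur complement of the
  last pivot \<open>d\<close>.\<close>

lemma psd_gram:
  assumes "symm n a" "\<And>x. 0 \<le> bform n a x x"
  shows "\<exists>(m::nat) v. \<forall>i<n. \<forall>j<n. a i j = (\<Sum>l<m. v i l * v j l)"
  using assms
proof (induction n arbitrary: a)
  case 0
  then show ?case by simp
next
  case (Suc n)
  note sym = Suc.prems(1) and psd = Suc.prems(2)
  define d where "d = a n n"
  \<comment> \<open>For a zero pivot the column \<open>a i n\<close> vanishes, so that \<open>x / 0 = 0\<close> gives the right value.\<close>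
  define b where "b = (\<lambda>i j. a i j - a i n * a j n / d)"
  have d: "0 \<le> d"
    using psd[of "unitv n"] by (simp add: bform_unitv_left mulv_unitv d_def)
  have zero_pivot: "a i n = 0" if "d = 0" "i < n" for i
  proof -
    have "(bform (Suc n) a (unitv i) (unitv n))\<^sup>2 \<le>
        bform (Suc n) a (unitv i) (unitv i) * bform (Suc n) a (unitv n) (unitv n)"
      by (rule bform_Cauchy_Schwarz[OF sym psd])
    then show ?thesis using that by (simp add: bform_unitv_left mulv_unitv d_def)
  qed
  have "symm n b"
    using sym by (simp add: symm_def b_def)
  moreover have "0 \<le> bform n b x x" for x
  proof -
    define L where "L = (\<Sum>i<n. x i * a i n)"
    \<comment> \<open>This last entry minimizes the form over that coordinate; the minimum is the
      Schur complement form.\<close>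
    define y where "y = x(n := - L / d)"
    have L: "L = 0" if "d = 0" using zero_pivot[OF that] by (simp add: L_def)
    have "0 \<le> bform (Suc n) a y y" by (rule psd)
    also have "\<dots> = bform n a y y + 2 * y n * (\<Sum>i<n. y i * a i n) + (y n)\<^sup>2 * d"
      by (simp add: bform_Suc[OF sym] d_def)
    also have "bform n a y y = bform n a x x"
      by (rule bform_cong) (auto simp: y_def)
    also have "(\<Sum>i<n. y i * a i n) = L"
      by (simp add: y_def L_def)
    also have "bform n a x x + 2 * y n * L + (y n)\<^sup>2 * d = bform n a x x - L\<^sup>2 / d"
      using L by (cases "d = 0") (auto simp: y_def field_simps power2_eq_square)
    also have "\<dots> = bform n b x x"
    proof -
      have "b = (\<lambda>i j. a i j - (1 / d) * (a i n * a j n))" by (simp add: b_def)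
      then show ?thesis
        by (simp only: bform_diff_coeffs bform_scale_coeffs bform_rank_one)
          (simp add: L_def mult.commute)
    qed
    finally show ?thesis .
  qed
  ultimately obtain m :: nat and v where v: "\<forall>i<n. \<forall>j<n. b i j = (\<Sum>l<m. v i l * v j l)"
    using Suc.IH[of b] by blast
  \<comment> \<open>Column \<open>m\<close> restores the rank-one term removed with the pivot; it is
    zero for \<open>d = 0\<close>.\<close>
  define w where "w = (\<lambda>i l. if l = m then a i n / sqrt d else if i = n then 0 else v i l)"
  have "a i j = (\<Sum>l<Suc m. w i l * w j l)" if "i < Suc n" "j < Suc n" for i j
  proof -
    have "(\<Sum>l<m. w i l * w j l) = (if i = n \<or> j = n then 0 else b i j)"
      using v that by (auto simp: w_def)
    moreover have "w i m * w j m = a i n * a j n / d"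
      using d by (simp add: w_def)
    moreover have "a n j = a j n"
      using sym that unfolding symm_def by blast
    ultimately show ?thesis
      using zero_pivot[of i] zero_pivot[of j] that
      by (cases "i = n"; cases "j = n"; cases "d = 0")
        (simp_all add: b_def flip: d_def)
  qed
  then show ?case by blast
qed

section \<open>Matrices and their entry functions\<close>

abbreviation entries :: "real mat \<Rightarrow> nat \<Rightarrow> nat \<Rightarrow> real" where
  "entries M \<equiv> \<lambda>i j. M $$ (i, j)"

lemma sym_mats_iff: "M \<in> sym_mats n \<longleftrightarrow> M \<in> carrier_mat n n \<and> symm n (entries M)"
proof -
  have "transpose_mat M = M \<longleftrightarrow> symm n (entries M)" if "M \<in> carrier_mat n n"
  proof
    assume "transpose_mat M = M"
    then show "symm n (entries M)"
      using that unfolding symm_def by (metis carrier_matD index_transpose_mat(1))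
  next
    assume "symm n (entries M)"
    then show "transpose_mat M = M"
      using that unfolding symm_def by (intro eq_matI) auto
  qed
  then show ?thesis by (auto simp: sym_mats_def)
qed

lemma scalar_prod_mult_mat_vec:
  assumes "M \<in> carrier_mat n n"
  shows "vec n x \<bullet> (M *\<^sub>v vec n x) = bform n (entries M) x x"
  using assms
  by (simp add: scalar_prod_def bform_mulv mulv_def atLeast0LessThan)

lemma psd_mats_iff:
  "M \<in> psd_mats n \<longleftrightarrow> M \<in> sym_mats n \<and> (\<forall>x. 0 \<le> bform n (entries M) x x)"
proof -
  have "(\<forall>x\<in>carrier_vec n. 0 \<le> x \<bullet> (M *\<^sub>v x)) \<longleftrightarrow> (\<forall>x. 0 \<le> bform n (entries M) x x)"
    if M: "M \<in> carrier_mat n n"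
  proof
    assume *: "\<forall>x\<in>carrier_vec n. 0 \<le> x \<bullet> (M *\<^sub>v x)"
    have "0 \<le> bform n (entries M) x x" for x
      using bspec[OF *, of "vec n x"] scalar_prod_mult_mat_vec[OF M, of x] by simp
    then show "\<forall>x. 0 \<le> bform n (entries M) x x" ..
  next
    assume *: "\<forall>x. 0 \<le> bform n (entries M) x x"
    have "0 \<le> x \<bullet> (M *\<^sub>v x)" if "x \<in> carrier_vec n" for x
    proof -
      have "vec n (($) x) = x" using that by auto
      then show ?thesis
        using scalar_prod_mult_mat_vec[OF M, of "($) x"] * by simp
    qed
    then show "\<forall>x\<in>carrier_vec n. 0 \<le> x \<bullet> (M *\<^sub>v x)" by blast
  qed
  then show ?thesis by (auto simp: psd_mats_def sym_mats_def)
qed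

lemma mat_inner_gram:
  assumes "Y \<in> carrier_mat n n" "V \<in> carrier_mat n m"
  shows "mat_inner Y (V * transpose_mat V) =
    (\<Sum>l<m. bform n (entries Y) (\<lambda>i. V $$ (i, l)) (\<lambda>i. V $$ (i, l)))"
proof -
  have "mat_inner Y (V * transpose_mat V) =
      (\<Sum>i<n. \<Sum>j<n. \<Sum>l<m. V $$ (i, l) * Y $$ (i, j) * V $$ (j, l))"
    using assms unfolding mat_inner_def
    by (intro sum.cong)
      (auto simp: scalar_prod_def atLeast0LessThan sum_distrib_left mult_ac)
  also have "\<dots> = (\<Sum>i<n. \<Sum>l<m. \<Sum>j<n. V $$ (i, l) * Y $$ (i, j) * V $$ (j, l))"
    by (intro sum.cong refl sum.swap)
  also have "\<dots> = (\<Sum>l<m. \<Sum>i<n. \<Sum>j<n. V $$ (i, l) * Y $$ (i, j) * V $$ (j, l))"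
    by (rule sum.swap)
  finally show ?thesis by (simp add: bform_def)
qed

lemma gram_psd:
  assumes "V \<in> carrier_mat n m"
  shows "V * transpose_mat V \<in> psd_mats n"
proof -
  have "0 \<le> bform n (entries (V * transpose_mat V)) x x" for x
  proof -
    \<comment> \<open>The form at \<open>x\<close> is the inner product with the matrix of entries
      \<open>x i * x j\<close>, to which \<open>mat_inner_gram\<close> applies.\<close>
    have "bform n (entries (V * transpose_mat V)) x x =
        mat_inner (mat n n (\<lambda>(i, j). x i * x j)) (V * transpose_mat V)"
      using assms unfolding mat_inner_def bform_def
      by (intro sum.cong) auto
    also have "\<dots> = (\<Sum>l<m. (\<Sum>i<n. x i * V $$ (i, l))\<^sup>2)"
      using assms by (subst mat_inner_gram[of _ n _ m])
        (auto simp: bform_def power2_eq_square sum_product mult_ac intro!: sum.cong)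
    finally show ?thesis by (simp add: sum_nonneg)
  qed
  moreover have "transpose_mat (V * transpose_mat V) = V * transpose_mat V"
    using assms by (subst transpose_mult) auto
  ultimately show ?thesis
    using assms by (simp add: psd_mats_iff sym_mats_def)
qed

text \<open>A bound on \<open>factor_width\<close> yields a factorization only when some width is
  attained at all. \<open>psd_gram\<close> ensures this: columns of length \<open>n\<close> have at
  most \<open>n\<close> nonzero entries.\<close>

lemma FW_iff:
  "M \<in> FW k n \<longleftrightarrow> (\<exists>m. \<exists>V \<in> carrier_mat n m.
     M = V * transpose_mat V \<and> (\<forall>l<m. card {i. i < n \<and> V $$ (i, l) \<noteq> 0} \<le> k))"
    (is "_ \<longleftrightarrow> ?P k")
proof
  assume M: "M \<in> FW k n"
  then have psd: "M \<in> psd_mats n" and k: "factor_width M \<le> k" by (auto simp: FW_def)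
  then have dim: "M \<in> carrier_mat n n" and sym: "symm n (entries M)"
    by (auto simp: psd_mats_iff sym_mats_iff)
  have fw: "factor_width M = (LEAST k. ?P k)"
    using dim by (simp add: factor_width_def)
  obtain m :: nat and v where v: "\<forall>i<n. \<forall>j<n. M $$ (i, j) = (\<Sum>l<m. v i l * v j l)"
    using psd_gram[OF sym] psd by (auto simp: psd_mats_iff)
  define V where "V = mat n m (\<lambda>(i, l). v i l)"
  have "M = V * transpose_mat V"
    using dim v by (intro eq_matI) (auto simp: V_def scalar_prod_def atLeast0LessThan)
  moreover have "card {i. i < n \<and> V $$ (i, l) \<noteq> 0} \<le> n" for l
    using card_mono[of "{..<n}" "{i. i < n \<and> V $$ (i, l) \<noteq> 0}"] by auto
  moreover have "V \<in> carrier_mat n m" by (simp add: V_def)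
  ultimately have "?P n" by blast
  then have "?P (factor_width M)" unfolding fw by (rule LeastI)
  then show "?P k" using k by (meson le_trans)
next
  assume P: "?P k"
  then have psd: "M \<in> psd_mats n" using gram_psd by blast
  then have "dim_row M = n" by (auto simp: psd_mats_def sym_mats_def)
  then have "factor_width M = (LEAST k. ?P k)"
    by (simp add: factor_width_def)
  then show "M \<in> FW k n" using Least_le[of ?P, OF P] psd by (simp add: FW_def)
qed

text \<open>The cone is generated by the products \<open>V * transpose_mat V\<close> with a single
  sparse column, and pairing with such a product evaluates the form at that column.\<close>

lemma dual_FW_iff:
  "Y \<in> dual_cone n (FW k n) \<longleftrightarrow> Y \<in> sym_mats n \<and>
     (\<forall>x. card {i. i < n \<and> x i \<noteq> 0} \<le> k \<longrightarrow> 0 \<le> bform n (entries Y) x x)"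
proof (cases "Y \<in> sym_mats n")
  case True
  then have Y: "Y \<in> carrier_mat n n" by (simp add: sym_mats_iff)
  have "(\<forall>X\<in>FW k n. 0 \<le> mat_inner Y X) \<longleftrightarrow>
     (\<forall>x. card {i. i < n \<and> x i \<noteq> 0} \<le> k \<longrightarrow> 0 \<le> bform n (entries Y) x x)"
  proof (intro iffI allI impI ballI)
    fix x :: "nat \<Rightarrow> real" assume *: "\<forall>X\<in>FW k n. 0 \<le> mat_inner Y X" "card {i. i < n \<and> x i \<noteq> 0} \<le> k"
    define V where "V = mat n 1 (\<lambda>(i, l). x i)"
    have V: "V \<in> carrier_mat n 1" by (simp add: V_def)
    have "{i. i < n \<and> V $$ (i, l) \<noteq> 0} = {i. i < n \<and> x i \<noteq> 0}" if "l < 1" for l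
      using that by (auto simp: V_def)
    then have "V * transpose_mat V \<in> FW k n"
      unfolding FW_iff using V *(2) by (intro exI[of _ 1] bexI[of _ V]) auto
    then have "0 \<le> mat_inner Y (V * transpose_mat V)" using * by blast
    also have "\<dots> = bform n (entries Y) (\<lambda>i. V $$ (i, 0)) (\<lambda>i. V $$ (i, 0))"
      by (simp add: mat_inner_gram[OF Y V])
    also have "\<dots> = bform n (entries Y) x x"
      by (rule bform_cong) (auto simp: V_def)
    finally show "0 \<le> bform n (entries Y) x x" .
  next
    fix X assume *: "\<forall>x. card {i. i < n \<and> x i \<noteq> 0} \<le> k \<longrightarrow> 0 \<le> bform n (entries Y) x x"
      "X \<in> FW k n"
    from *(2) obtain m V where "V \<in> carrier_mat n m" "X = V * transpose_mat V"
      "\<forall>l<m. card {i. i < n \<and> V $$ (i, l) \<noteq> 0} \<le> k"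
      unfolding FW_iff by blast
    then show "0 \<le> mat_inner Y X"
      using * by (auto simp: mat_inner_gram[OF Y] intro!: sum_nonneg)
  qed
  then show ?thesis using True by (simp add: dual_cone_def)
qed (simp add: dual_cone_def)

lemma dual_FW_corank_one_iff:
  assumes "n \<noteq> 0"
  shows "Y \<in> dual_cone n (FW (n - 1) n) \<longleftrightarrow> Y \<in> sym_mats n \<and> sparse_nonneg n (entries Y)"
proof -
  \<comment> \<open>For \<open>n = 0\<close> this count would fail: the empty support has size at
    most \<open>n - 1 = 0\<close>, yet there is no index.\<close>
  have "card {i. i < n \<and> x i \<noteq> 0} \<le> n - 1 \<longleftrightarrow> (\<exists>i<n. x i = 0)" for x :: "nat \<Rightarrow> real"
  proof
    assume *: "card {i. i < n \<and> x i \<noteq> 0} \<le> n - 1"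
    show "\<exists>i<n. x i = 0"
    proof (rule ccontr)
      assume "\<not> (\<exists>i<n. x i = 0)"
      then have "{i. i < n \<and> x i \<noteq> 0} = {..<n}" by auto
      then show False using * assms by simp
    qed
  next
    assume "\<exists>i<n. x i = 0"
    then have "{i. i < n \<and> x i \<noteq> 0} \<subset> {..<n}" by auto
    then show "card {i. i < n \<and> x i \<noteq> 0} \<le> n - 1"
      using psubset_card_mono[of "{..<n}" "{i. i < n \<and> x i \<noteq> 0}"] by simp
  qed
  then show ?thesis unfolding dual_FW_iff sparse_nonneg_def by blast
qed

section \<open>Principal submatrices\<close>

lemma bij_betw_pick:
  assumes "finite I"
  shows "bij_betw (pick I) {..<card I} I"
proof -
  have "inj_on (pick I) {..<card I}"
    by (rule inj_onI) (metis card_pick_le lessThan_iff)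
  moreover have "pick I ` {..<card I} \<subseteq> I"
    using pick_in_set_le by auto
  ultimately show ?thesis
    using assms by (simp add: bij_betw_def card_image card_subset_eq)
qed

lemma submatrix_principal:
  assumes "M \<in> carrier_mat n n" "I \<subseteq> {..<n}"
  shows "submatrix M I I = mat (card I) (card I) (\<lambda>(r, s). M $$ (pick I r, pick I s))"
proof -
  have "{i. i < n \<and> i \<in> I} = I" using assms(2) by auto
  then show ?thesis using assms(1) by (simp add: submatrix_def)
qed

lemma coordinate_complement:
  assumes "I \<subseteq> {..<n}" "card I = n - 1" "n \<noteq> 0"
  obtains i where "i < n" "I = {..<n} - {i}"
proof -
  have "card ({..<n} - I) = 1"
    using assms by (subst card_Diff_subset) (auto intro: finite_subset)
  then obtain i where "{..<n} - I = {i}" by (auto simp: card_1_singleton_iff)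
  then have "i < n" "I = {..<n} - {i}" using assms(1) by auto
  then show ?thesis using that by blast
qed

context sparse_nonneg_indefinite
begin

text \<open>Padding with a zero at \<open>i\<close> turns kernel vectors of the submatrix into
  witnesses of \<open>singular_at i\<close>. As the corank is at most one, singularity alone fixes
  the rank. Writing \<open>Suc\<close> avoids truncated subtraction at \<open>m = 0\<close>.\<close>

lemma principal_rank_iff:
  assumes i: "i < n" and g: "bij_betw g {..<m} ({..<n} - {i})"
  shows "Suc (vec_space.rank m (mat m m (\<lambda>(r, s). a (g r) (g s)))) = m \<longleftrightarrow> singular_at i"
proof -
  let ?b = "\<lambda>r s. a (g r) (g s)"
  have sum: "(\<Sum>s<m. f (g s) * x (g s)) = (\<Sum>k<n. f k * x k)" if "x i = 0"
    for f x :: "nat \<Rightarrow> real"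
  proof -
    have "(\<Sum>s<m. f (g s) * x (g s)) = (\<Sum>k\<in>{..<n} - {i}. f k * x k)"
      by (rule sum.reindex_bij_betw[OF g])
    also have "\<dots> = (\<Sum>k<n. f k * x k)"
      using that by (intro sum.mono_neutral_left) auto
    finally show ?thesis .
  qed
  have mulv: "mulv m ?b (\<lambda>s. x (g s)) r = mulv n a x (g r)" if "x i = 0" for x r
    unfolding mulv_def by (rule sum) (rule that)
  have all: "(\<forall>k<n. k \<noteq> i \<longrightarrow> P k) \<longleftrightarrow> (\<forall>r<m. P (g r))" for P
  proof -
    have "{..<n} - {i} = g ` {..<m}" using g by (simp add: bij_betw_def)
    then have "(\<forall>k\<in>{..<n} - {i}. P k) \<longleftrightarrow> (\<forall>r<m. P (g r))" by auto
    then show ?thesis by auto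
  qed
  show ?thesis
  proof
    assume "Suc (vec_space.rank m (mat m m (\<lambda>(r, s). ?b r s))) = m"
    then have "det (mat m m (\<lambda>(r, s). ?b r s)) = 0"
      using vec_space.det_rank_iff[of "mat m m (\<lambda>(r, s). ?b r s)" m] by fastforce
    then obtain y where y: "\<exists>r<m. y r \<noteq> 0" "\<forall>r<m. mulv m ?b y r = 0"
      unfolding det_zero_iff_mulv by blast
    define u where "u = (\<lambda>k. if k = i then 0 else y (inv_into {..<m} g k))"
    have ug: "u (g r) = y r" if "r < m" for r
      using g that bij_betw_inv_into_left[OF g] bij_betwE[OF g] by (auto simp: u_def)
    have ui: "u i = 0" by (simp add: u_def)
    have "mulv n a u (g r) = 0" if "r < m" for r
    proof -
      have "mulv n a u (g r) = mulv m ?b (\<lambda>s. u (g s)) r" by (simp add: mulv[of u] ui)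
      also have "\<dots> = mulv m ?b y r" by (rule mulv_cong) (rule ug)
      finally show ?thesis using y that by simp
    qed
    then have "\<forall>k<n. k \<noteq> i \<longrightarrow> mulv n a u k = 0" unfolding all by blast
    moreover have "\<exists>k<n. u k \<noteq> 0"
      using y(1) ug bij_betwE[OF g] by (metis Diff_iff lessThan_iff)
    ultimately show "singular_at i" using ui unfolding singular_at_def by blast
  next
    assume "singular_at i"
    then obtain u where u: "u i = 0" "\<exists>j<n. u j \<noteq> 0" "\<forall>r<n. r \<noteq> i \<longrightarrow> mulv n a u r = 0"
      unfolding singular_at_def by blast
    show "Suc (vec_space.rank m (mat m m (\<lambda>(r, s). ?b r s))) = m"
    proof (rule rank_corank_one[where u = "\<lambda>r. u (g r)"])
      show "symm m ?b"
        using sym bij_betwE[OF g] unfolding symm_def by blast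
      show "\<forall>r<m. mulv m ?b (\<lambda>s. u (g s)) r = 0"
        using u(3) by (simp add: mulv[of u, OF u(1)] all)
      show "\<exists>r<m. u (g r) \<noteq> 0"
        using u(1,2) all[of "\<lambda>k. u k = 0"] by metis
    next
      fix y assume y: "\<forall>r<m. mulv m ?b y r = 0" "(\<Sum>r<m. u (g r) * y r) = 0"
      define x where "x = (\<lambda>k. if k = i then 0 else y (inv_into {..<m} g k))"
      have xg: "x (g r) = y r" if "r < m" for r
        using g that bij_betw_inv_into_left[OF g] bij_betwE[OF g] by (auto simp: x_def)
      have xi: "x i = 0" by (simp add: x_def)
      have "mulv n a x (g r) = 0" if "r < m" for r
      proof -
        have "mulv n a x (g r) = mulv m ?b (\<lambda>s. x (g s)) r" by (simp add: mulv[of x] xi)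
        also have "\<dots> = mulv m ?b y r" by (rule mulv_cong) (rule xg)
        finally show ?thesis using y that by simp
      qed
      then have "\<forall>k<n. k \<noteq> i \<longrightarrow> mulv n a x k = 0" unfolding all by blast
      moreover have "(\<Sum>k<n. u k * x k) = 0"
        using y(2) sum[of x u] xi by (simp add: xg)
      ultimately have "\<forall>k<n. x k = 0"
        using principal_kernel_one_dim[OF u] xi by blast
      then show "\<forall>r<m. y r = 0"
        using xg bij_betwE[OF g] by (metis Diff_iff lessThan_iff)
    qed
  qed
qed

end

text \<open>For \<open>n = 2\<close> the matrix with zero diagonal and off-diagonal entries
  \<open>1\<close> satisfies the rank condition, but its negative is also in the cone, so it is not
  extreme. Comparing ranks in \<open>int\<close> makes the condition false for \<open>n = 1\<close>,
  where truncated subtraction would make it true.\<close>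

theorem theorem4p4:
  fixes n :: nat and A :: "real mat"
  assumes "n \<noteq> 2"
    and "A \<in> dual_cone n (FW (n - 1) n)"
    and "A \<notin> psd_mats n"
  shows "spans_extreme_ray (dual_cone n (FW (n - 1) n)) A \<longleftrightarrow>
    (\<forall>I. I \<subseteq> {..<n} \<and> card I = n - 1 \<longrightarrow>
       int (vec_space.rank (n - 1) (submatrix A I I)) = int n - 2)"
proof -
  let ?D = "dual_cone n (FW (n - 1) n)"
  have A_sym: "A \<in> sym_mats n" using assms(2) by (simp add: dual_cone_def)
  then have dim: "A \<in> carrier_mat n n" by (simp add: sym_mats_def)
  obtain z where z: "bform n (entries A) z z < 0"
    using assms(3) A_sym unfolding psd_mats_iff by (meson not_less)
  then have n: "n \<noteq> 0" by (auto simp: bform_def intro: ccontr)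
  note dual_iff = dual_FW_corank_one_iff[OF n]
  interpret sparse_nonneg_indefinite n "entries A"
    using assms(2) z unfolding dual_iff sym_mats_iff by unfold_locales blast+
  have A0: "A \<noteq> 0\<^sub>m (dim_row A) (dim_col A)"
    using z dim by (auto simp: bform_def)
  have rank: "int (vec_space.rank (n - 1) (submatrix A I I)) = int n - 2 \<longleftrightarrow> singular_at i"
    if i: "i < n" "I = {..<n} - {i}" for i I
  proof -
    have I: "card I = n - 1" "I \<subseteq> {..<n}" "finite I" using i by auto
    have "bij_betw (pick I) {..<n - 1} ({..<n} - {i})"
      using bij_betw_pick[OF I(3)] I(1) i(2) by simp
    from principal_rank_iff[OF i(1) this]
    have "Suc (vec_space.rank (n - 1) (submatrix A I I)) = n - 1 \<longleftrightarrow> singular_at i"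
      using submatrix_principal[OF dim I(2)] I(1) by simp
    then show ?thesis using n by linarith
  qed
  have ranks: "(\<forall>I. I \<subseteq> {..<n} \<and> card I = n - 1 \<longrightarrow>
      int (vec_space.rank (n - 1) (submatrix A I I)) = int n - 2) \<longleftrightarrow> (\<forall>i<n. singular_at i)"
  proof (intro iffI allI impI)
    fix i assume *: "\<forall>I. I \<subseteq> {..<n} \<and> card I = n - 1 \<longrightarrow>
      int (vec_space.rank (n - 1) (submatrix A I I)) = int n - 2" "i < n"
    then show "singular_at i"
      using rank[OF *(2) refl] by simp
  next
    fix I assume *: "\<forall>i<n. singular_at i" "I \<subseteq> {..<n} \<and> card I = n - 1"
    then obtain i where "i < n" "I = {..<n} - {i}"
      using coordinate_complement n by blast
    then show "int (vec_space.rank (n - 1) (submatrix A I I)) = int n - 2"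
      using rank * by blast
  qed
  have "singular_at i" if extreme: "spans_extreme_ray ?D A" and i: "i < n" for i
  proof (rule ccontr)
    assume "\<not> singular_at i"
    then obtain t where t: "t > 0"
      "sparse_nonneg n (\<lambda>r s. A $$ (r, s) - t * (A $$ (r, i) * A $$ (s, i)))"
      using subtract_rank_one[OF i] by blast
    define X where "X = mat n n (\<lambda>(r, s). t * (A $$ (r, i) * A $$ (s, i)))"
    define Y where "Y = mat n n (\<lambda>(r, s). A $$ (r, s) - t * (A $$ (r, i) * A $$ (s, i)))"
    have bX: "bform n (entries X) x x = t * (\<Sum>r<n. A $$ (r, i) * x r)\<^sup>2" for x
    proof -
      have "bform n (entries X) x x = bform n (\<lambda>r s. t * (A $$ (r, i) * A $$ (s, i))) x x"
        by (simp add: bform_def X_def)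
      then show ?thesis by (simp add: bform_scale_coeffs bform_rank_one)
    qed
    have "symm n (entries X)" "symm n (entries Y)"
      using sym by (auto simp: symm_def X_def Y_def)
    moreover have "sparse_nonneg n (entries X)"
      using t(1) by (simp add: sparse_nonneg_def bX)
    moreover have "sparse_nonneg n (entries Y)"
      using t(2) by (simp add: sparse_nonneg_def bform_def Y_def)
    ultimately have "X \<in> ?D" "Y \<in> ?D"
      unfolding dual_iff sym_mats_iff by (auto simp: X_def Y_def)
    moreover have "A = X + Y"
      using dim by (intro eq_matI) (auto simp: X_def Y_def)
    ultimately obtain c where c: "c \<ge> 0" "X = c \<cdot>\<^sub>m A"
      using extreme unfolding spans_extreme_ray_def by blast
    \<comment> \<open>The form of \<open>X\<close> is nonnegative at \<open>z\<close> while that of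
      \<open>A\<close> is negative, so \<open>c = 0\<close>. Then the diagonal of \<open>X\<close>
      shows that column \<open>i\<close> of \<open>A\<close> is zero, against regularity.\<close>
    have bXA: "bform n (entries X) x x = c * bform n (entries A) x x" for x
      unfolding bform_scale_coeffs[symmetric] using dim by (simp add: c bform_def)
    then have "0 \<le> c * bform n (entries A) z z"
      using t(1) bX[of z] by (simp flip: bXA)
    then have "c = 0" using c(1) z by (simp add: zero_le_mult_iff)
    then have "X $$ (r, r) = 0" if "r < n" for r
      using c(2) dim that by simp
    then have "A $$ (r, i) = 0" if "r < n" for r
      using t(1) that by (simp add: X_def)
    then have "mulv n (entries A) (unitv i) r = 0" if "r < n" for r
      using that i by (simp add: mulv_unitv)
    then show False using regular[of "unitv i"] i by (auto simp: unitv_simps)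
  qed
  moreover have "spans_extreme_ray ?D A" if sing: "\<forall>i<n. singular_at i"
  proof -
    have n3: "n \<ge> 3"
    proof (rule ccontr)
      assume "\<not> n \<ge> 3"
      then have "n = 1" using assms(1) n by auto
      \<comment> \<open>A vector vanishing at the only index is zero, so \<open>singular_at\<close>
        fails.\<close>
      then show False using sing unfolding singular_at_def by auto
    qed
    have multiple: "\<exists>c\<ge>0. X = c \<cdot>\<^sub>m A" if XY: "X \<in> ?D" "Y \<in> ?D" "A = X + Y" for X Y
    proof -
      have X: "X \<in> carrier_mat n n" "symm n (entries X)" "sparse_nonneg n (entries X)"
        and Y: "Y \<in> carrier_mat n n" "sparse_nonneg n (entries Y)"
        using XY(1,2) unfolding dual_iff sym_mats_iff by auto
      obtain c where "c \<ge> 0" "\<forall>r<n. \<forall>s<n. X $$ (r, s) = c * A $$ (r, s)"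
        using summand_multiple[OF n3 X(2,3) Y(2)] sing X Y XY(3) by auto
      moreover from this have "X = c \<cdot>\<^sub>m A"
        using X dim by (intro eq_matI) auto
      ultimately show ?thesis by blast
    qed
    have "\<exists>b\<ge>0. Y = b \<cdot>\<^sub>m A" if "X \<in> ?D" "Y \<in> ?D" "A = X + Y" for X Y
    proof -
      have "A = Y + X"
        using that comm_add_mat[of X n n Y] by (simp add: dual_cone_def sym_mats_def)
      then show ?thesis using multiple that by blast
    qed
    then show ?thesis
      unfolding spans_extreme_ray_def using multiple assms(2) A0 by blast
  qed
  ultimately show ?thesis unfolding ranks by blast
qed

end
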